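(* Let $s\geq 2$ be an integer and let $G$ be a finite group with $d(G)>1/s$. Let $N$ be an abelian normal nontrivial subgroup of $G$ and suppose that $G$ splits over $N$. Then there exists a nontrivial conjugacy class of $G$ contained in $N$ of size at most $s-1$. In particular, either $\mathbf{Z}(G)\neq 1$ or $G$ has a proper subgroup of index at most $s-1$.
   Context: For a finite group $G$, $d(G) := \frac{1}{|G|^2}\,|\{(x,y)\in G\times G \mid xy=yx\}|$ is the commuting probability of $G$; equivalently $d(G)=k(G)/|G|$, where $k(G)$ is the number of conjugacy classes of $G$. $\mathbf{Z}(G)$ denotes the center of $G$. $G$ splits over a normal subgroup $N$ if there is a subgroup $H\le G$ with $G=HN$ and $H\cap N=1$. A nontrivial conjugacy class is the class of a non-identity element (i.e. a class different from $\{1\}$; it may have size 1). *)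

theory Defs
  imports Complex_Main "HOL-Algebra.Algebra"
begin

definition commuting_probability :: "('a, 'b) monoid_scheme \<Rightarrow> real" where
  "commuting_probability G =
     real (card {(x, y) \<in> carrier G \<times> carrier G. x \<otimes>\<^bsub>G\<^esub> y = y \<otimes>\<^bsub>G\<^esub> x}) / (real (order G))\<^sup>2"

definition group_center :: "('a, 'b) monoid_scheme \<Rightarrow> 'a set" where
  "group_center G = {z \<in> carrier G. \<forall>g \<in> carrier G. z \<otimes>\<^bsub>G\<^esub> g = g \<otimes>\<^bsub>G\<^esub> z}"

text \<open>The action used here is the one of the library theorem \<open>group.action_by_conjugation\<close>.\<close>

definition conjugacy_classes :: "('a, 'b) monoid_scheme \<Rightarrow> 'a set set" where
  "conjugacy_classes G =
     orbits G (carrier G) (\<lambda>g. \<lambda>h \<in> carrier G. g \<otimes>\<^bsub>G\<^esub> h \<otimes>\<^bsub>G\<^esub> inv\<^bsub>G\<^esub> g)"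

definition splits_over :: "('a, 'b) monoid_scheme \<Rightarrow> 'a set \<Rightarrow> bool" where
  "splits_over G N \<longleftrightarrow>
     (\<exists>H. subgroup H G \<and> H <#>\<^bsub>G\<^esub> N = carrier G \<and> H \<inter> N = {\<one>\<^bsub>G\<^esub>})"

end

theory Submission
  imports Defs
begin

text \<open>
  Suppose every nontrivial class in \<open>N\<close> has size at least \<open>s\<close>, and let \<open>G\<close> act on the complex
  characters of \<open>N\<close>. Write \<open>n\<close> for the order of \<open>N\<close> and \<open>\<beta>(f)\<close> for the reciprocal of the size of
  the orbit of the character \<open>f\<close>. Orthogonality of characters, applied to commutators of elements
  of two cosets of \<open>N\<close>, gives \<open>n d(G) \<le> \<Sum> \<beta>(f)\<^sup>2\<close>. It also shows that every group element fixes as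
  many characters as elements of \<open>N\<close>, so \<open>\<Sum> \<beta>(f)\<close> is the sum over \<open>N\<close> of the reciprocals of the
  class sizes, which is at most \<open>1 + (n - 1) / s\<close>. This and \<open>n \<ge> s + 1\<close> force
  \<open>\<Sum> \<beta>(f)\<^sup>2 \<le> n / s\<close>, whence \<open>d(G) \<le> 1 / s\<close>.
\<close>

section \<open>Characters of finite abelian groups\<close>

text \<open>Extensionality fixes the values off \<open>S\<close>, so that a character is determined
  by its values on \<open>S\<close> and the set can be finite. The condition at the identity
  excludes the zero map.\<close>

definition characters :: "('a, 'b) monoid_scheme \<Rightarrow> 'a set \<Rightarrow> ('a \<Rightarrow> complex) set" where
  "characters G S =
     {f \<in> extensional S. f \<one>\<^bsub>G\<^esub> = 1 \<and> (\<forall>x\<in>S. \<forall>y\<in>S. f (x \<otimes>\<^bsub>G\<^esub> y) = f x * f y)}"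

lemma charactersI:
  assumes "f \<in> extensional S" "f \<one>\<^bsub>G\<^esub> = 1"
    and "\<And>x y. x \<in> S \<Longrightarrow> y \<in> S \<Longrightarrow> f (x \<otimes>\<^bsub>G\<^esub> y) = f x * f y"
  shows "f \<in> characters G S"
  using assms by (simp add: characters_def)

lemma character_one: "f \<in> characters G S \<Longrightarrow> f \<one>\<^bsub>G\<^esub> = 1"
  and character_mult: "f \<in> characters G S \<Longrightarrow> x \<in> S \<Longrightarrow> y \<in> S \<Longrightarrow> f (x \<otimes>\<^bsub>G\<^esub> y) = f x * f y"
  and character_extensional: "f \<in> characters G S \<Longrightarrow> f \<in> extensional S"
  by (simp_all add: characters_def)

lemma (in group) subgroup_nat_pow_closed:
  assumes "subgroup S G" "x \<in> S"
  shows "x [^] (n::nat) \<in> S"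
  using assms by (induction n) (auto simp: subgroup.one_closed subgroup.m_closed)

lemma (in group) character_pow:
  assumes "subgroup S G" "f \<in> characters G S" "x \<in> S"
  shows "f (x [^] (n::nat)) = f x ^ n"
proof (induction n)
  case 0
  then show ?case using assms by (simp add: character_one)
next
  case (Suc n)
  have "x [^] n \<in> S"
    using assms subgroup_nat_pow_closed by blast
  then show ?case
    using Suc assms by (simp add: character_mult)
qed

lemma (in group) character_inv:
  assumes "subgroup S G" "f \<in> characters G S" "x \<in> S"
  shows "f (inv x) = inverse (f x)"
proof -
  have "f x * f (inv x) = f (x \<otimes> inv x)"
    using assms by (simp add: character_mult subgroup.m_inv_closed)
  also have "\<dots> = 1"
    using assms by (simp add: character_one subgroup.mem_carrier)
  finally show ?thesis
    by (metis inverse_unique)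
qed

lemma (in group) character_root_of_unity:
  assumes "finite (carrier G)" "subgroup S G" "f \<in> characters G S" "x \<in> S"
  shows "f x ^ order G = 1"
  using character_pow[OF assms(2-4), of "order G"] pow_order_eq_1[of x] assms
  by (simp add: character_one subgroup.mem_carrier)

lemma (in group) norm_character:
  assumes "finite (carrier G)" "subgroup S G" "f \<in> characters G S" "x \<in> S"
  shows "norm (f x) = 1"
  using power_eq_1_iff[OF character_root_of_unity[OF assms]] assms(1) order_gt_0_iff_finite by simp

text \<open>All values are roots of unity for the single exponent \<open>order G\<close>, which
  leaves finitely many functions on \<open>S\<close>.\<close>

lemma (in group) finite_characters:
  assumes "finite (carrier G)" "subgroup S G"
  shows "finite (characters G S)"
proof (rule finite_subset)
  show "characters G S \<subseteq> (\<Pi>\<^sub>E x\<in>S. {z. z ^ order G = 1})"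
    using character_root_of_unity[OF assms] character_extensional
    by (auto simp: PiE_def)
  show "finite (\<Pi>\<^sub>E x\<in>S. {z::complex. z ^ order G = 1})"
  proof (rule finite_PiE)
    show "finite S"
      using assms finite_subset subgroup.subset by blast
    show "finite {z::complex. z ^ order G = 1}" for i :: 'a
      using assms order_gt_0_iff_finite by (intro finite_roots_unity) (simp add: Suc_leI)
  qed
qed

text \<open>Let \<open>k\<close> be the least positive exponent with \<open>g [^] k\<close> in
  \<open>S\<close>. The only constraint on a value \<open>w\<close> at \<open>g\<close> is
  \<open>w ^ k = f (g [^] k)\<close>; any such \<open>w\<close> extends \<open>f\<close> by sending
  \<open>s \<otimes> g [^] i\<close> to \<open>f s * w ^ i\<close>. That \<open>k \<ge> 2\<close>
  leaves a choice of \<open>w\<close>, which the separation of points exploits.\<close>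

lemma (in comm_group) character_extend:
  assumes fin: "finite (carrier G)" and S: "subgroup S G" and f: "f \<in> characters G S"
    and g: "g \<in> carrier G" "g \<notin> S"
  obtains T k where "subgroup T G" "S \<subseteq> T" "g \<in> T" "k \<ge> 2" "g [^] (k::nat) \<in> S"
    "\<And>w. w ^ k = f (g [^] k) \<Longrightarrow> \<exists>h \<in> characters G T. h g = w \<and> (\<forall>s\<in>S. h s = f s)"
proof -
  define k where "k = (LEAST k::nat. k > 0 \<and> g [^] k \<in> S)"
  have "order G > 0 \<and> g [^] order G \<in> S"
    using fin g S order_gt_0_iff_finite pow_order_eq_1 subgroup.one_closed by simp
  then have k: "k > 0" "g [^] k \<in> S"
    unfolding k_def by (metis (mono_tags, lifting) LeastI)+
  have k_least: "k \<le> m" if "m > 0" "g [^] m \<in> S" for m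
    unfolding k_def using that by (simp add: Least_le)
  have "k \<noteq> 1"
    using k g by auto
  \<comment> \<open>Division with remainder: \<open>g [^] (m mod k)\<close> lies in \<open>S\<close>
    too, so minimality of \<open>k\<close> makes the remainder vanish.\<close>
  have dvd: "k dvd m" if m: "g [^] m \<in> S" for m
  proof -
    have 1: "g [^] (k * (m div k)) \<in> S"
      using k S g by (simp add: nat_pow_pow[symmetric] subgroup_nat_pow_closed)
    have "g [^] m = g [^] (k * (m div k)) \<otimes> g [^] (m mod k)"
      using g by (simp add: nat_pow_mult)
    then have "g [^] (m mod k) = inv (g [^] (k * (m div k))) \<otimes> g [^] m"
      using g by (simp add: inv_solve_left)
    then have "g [^] (m mod k) \<in> S"
      using 1 m S by (simp add: subgroup.m_closed subgroup.m_inv_closed)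
    then show ?thesis
      using k_least[of "m mod k"] k by (metis mod_greater_zero_iff_not_dvd mod_less_divisor not_le)
  qed
  define T where "T = S <#> generate G {g}"
  have T: "subgroup T G"
    unfolding T_def using S g by (intro mult_subgroups generate_is_subgroup) auto
  \<comment> \<open>As \<open>g\<close> has finite order, its natural powers already exhaust
    \<open>generate G {g}\<close>.\<close>
  have T_iff: "x \<in> T \<longleftrightarrow> (\<exists>s\<in>S. \<exists>i::nat. x = s \<otimes> g [^] i)" for x
    unfolding T_def set_mult_def generate_pow_on_finite_carrier[OF fin g(1)] by auto
  have Scar: "s \<in> carrier G" if "s \<in> S" for s
    using subgroup.mem_carrier[OF S that] .
  have ext: "\<exists>h \<in> characters G T. h g = w \<and> (\<forall>s\<in>S. h s = f s)" if w: "w ^ k = f (g [^] k)" for w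
  proof -
    \<comment> \<open>Two representations of one element differ by \<open>g [^] (j - i)\<close>,
      which therefore lies in \<open>S\<close>. Hence \<open>k\<close> divides \<open>j - i\<close>,
      and the equation for \<open>w\<close> carries over to this power. The order
      \<open>i \<le> j\<close> keeps the subtraction of naturals exact.\<close>
    have wd_le: "f s * w ^ i = f t * w ^ j"
      if "s \<in> S" "t \<in> S" "s \<otimes> g [^] i = t \<otimes> g [^] j" "i \<le> j" for s t and i j :: nat
    proof -
      have "s \<otimes> g [^] i = (t \<otimes> g [^] (j - i)) \<otimes> g [^] i"
        using that g Scar by (simp add: m_assoc nat_pow_mult)
      then have s: "s = t \<otimes> g [^] (j - i)"
        using that g Scar by (metis m_closed nat_pow_closed r_cancel)
      then have "g [^] (j - i) = inv t \<otimes> s"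
        using that g Scar by (simp add: inv_solve_left)
      then have gS: "g [^] (j - i) \<in> S"
        using that S by (simp add: subgroup.m_closed subgroup.m_inv_closed)
      then obtain q where q: "j - i = k * q"
        using dvd by blast
      have "f s = f t * f (g [^] (j - i))"
        using s gS that f by (simp add: character_mult)
      also have "f (g [^] (j - i)) = w ^ (j - i)"
        using q k g S f w by (simp add: nat_pow_pow[symmetric] character_pow[OF S f] power_mult)
      finally show ?thesis
        using \<open>i \<le> j\<close> by (simp add: mult.assoc power_add[symmetric])
    qed
    have wd: "f s * w ^ i = f t * w ^ j"
      if "s \<in> S" "t \<in> S" "s \<otimes> g [^] i = t \<otimes> g [^] j" for s t and i j :: nat
      using wd_le[of s t i j] wd_le[of t s j i] that by (metis nle_le)
    \<comment> \<open>The choice is harmless: by \<open>wd\<close>, every representation of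
      \<open>x\<close> yields the same \<open>z\<close>.\<close>
    define h where "h = (\<lambda>x\<in>T. SOME z. \<exists>s\<in>S. \<exists>i::nat. x = s \<otimes> g [^] i \<and> z = f s * w ^ i)"
    have h: "h (s \<otimes> g [^] i) = f s * w ^ i" if "s \<in> S" for s and i :: nat
    proof -
      have "s \<otimes> g [^] i \<in> T"
        using that T_iff by blast
      moreover have "(SOME z. \<exists>t\<in>S. \<exists>j::nat. s \<otimes> g [^] i = t \<otimes> g [^] j \<and> z = f t * w ^ j) = f s * w ^ i"
      proof (rule some_equality)
        show "\<exists>t\<in>S. \<exists>j::nat. s \<otimes> g [^] i = t \<otimes> g [^] j \<and> f s * w ^ i = f t * w ^ j"
          using that by blast
        show "z = f s * w ^ i"
          if "\<exists>t\<in>S. \<exists>j::nat. s \<otimes> g [^] i = t \<otimes> g [^] j \<and> z = f t * w ^ j" for z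
          using that wd[OF \<open>s \<in> S\<close>] by fastforce
      qed
      ultimately show ?thesis
        by (simp add: h_def)
    qed
    have hS: "h s = f s" if "s \<in> S" for s
      using h[OF that, of 0] that Scar by simp
    have "h g = w"
      using h[of \<one> 1] S g f by (simp add: subgroup.one_closed character_one)
    moreover have "h \<in> characters G T"
    proof (rule charactersI)
      show "h \<in> extensional T"
        by (simp add: h_def)
      show "h \<one> = 1"
        using hS[of \<one>] S f by (simp add: subgroup.one_closed character_one)
      fix x y assume "x \<in> T" "y \<in> T"
      then obtain s t and i j :: nat where st: "s \<in> S" "t \<in> S" "x = s \<otimes> g [^] i" "y = t \<otimes> g [^] j"
        unfolding T_iff by blast
      have "x \<otimes> y = (s \<otimes> t) \<otimes> g [^] (i + j)"
        using st g Scar by (simp add: nat_pow_mult[symmetric] m_ac)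
      then have "h (x \<otimes> y) = f (s \<otimes> t) * w ^ (i + j)"
        using h[of "s \<otimes> t" "i + j"] st S by (simp add: subgroup.m_closed)
      also have "\<dots> = h x * h y"
        using st f h by (simp add: character_mult power_add)
      finally show "h (x \<otimes> y) = h x * h y" .
    qed
    ultimately show ?thesis
      using hS by blast
  qed
  have "S \<subseteq> T"
  proof
    fix s assume "s \<in> S"
    then show "s \<in> T"
      unfolding T_iff using Scar by (intro bexI[of _ s] exI[of _ 0]) auto
  qed
  moreover have "g \<in> T"
    unfolding T_iff using S g subgroup.one_closed by (intro bexI[of _ \<one>] exI[of _ 1]) auto
  moreover have "k \<ge> 2"
    using k \<open>k \<noteq> 1\<close> by linarith
  ultimately show ?thesis
    using that[OF T _ _ _ k(2) ext] by blast
qed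

text \<open>The trivial character of the trivial subgroup extends to a subgroup containing
  \<open>z\<close>, with a value other than 1 at \<open>z\<close>. Among the subgroups carrying such
  a character, one of maximal size is the whole group, since otherwise
  \<open>character_extend\<close> would enlarge it.\<close>

lemma (in comm_group) characters_separate:
  assumes fin: "finite (carrier G)" and z: "z \<in> carrier G" "z \<noteq> \<one>"
  obtains f where "f \<in> characters G (carrier G)" "f z \<noteq> 1"
proof -
  define P where "P S \<longleftrightarrow> subgroup S G \<and> z \<in> S \<and> (\<exists>f\<in>characters G S. f z \<noteq> 1)" for S
  have triv: "subgroup {\<one>} G"
    by (rule triv_subgroup)
  have triv_char: "(\<lambda>x\<in>{\<one>}. 1) \<in> characters G {\<one>}"
    by (rule charactersI) auto
  have "z \<notin> {\<one>}"
    using z by simp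
  then obtain T k where T: "subgroup T G" "{\<one>} \<subseteq> T" "z \<in> T" "k \<ge> 2" "z [^] (k::nat) \<in> {\<one>}"
    "\<And>w. w ^ k = (\<lambda>x\<in>{\<one>}. 1) (z [^] k) \<Longrightarrow>
      \<exists>h \<in> characters G T. h z = (w::complex) \<and> (\<forall>s\<in>{\<one>}. h s = (\<lambda>x\<in>{\<one>}. 1) s)"
    by (rule character_extend[OF fin triv triv_char z(1)]) (rule that)
  have T_ext: "\<exists>h \<in> characters G T. h z = w" if "w ^ k = 1" for w
    using T(6)[of w] T(5) that by auto
  \<comment> \<open>There are \<open>k \<ge> 2\<close> roots of unity available as the value at
    \<open>z\<close>, so one of them differs from 1.\<close>
  have "card {w::complex. w ^ k = 1} = k"
    using T by (intro card_roots_unity_eq) simp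
  then have "\<not> {w::complex. w ^ k = 1} \<subseteq> {1}"
    using T card_mono[of "{1::complex}" "{w. w ^ k = 1}"] by auto
  then have "P T"
    unfolding P_def using T(1,3) T_ext by blast
  moreover have "\<forall>S. P S \<longrightarrow> card S \<le> order G"
    unfolding P_def order_def using fin by (meson card_mono subgroup.subset)
  ultimately obtain S where S: "P S" and max: "\<And>S'. P S' \<Longrightarrow> card S' \<le> card S"
    using ex_has_greatest_nat[of P T card "Suc (order G)"] by (auto simp: less_Suc_eq_le)
  have "S = carrier G"
  proof (rule ccontr)
    assume "S \<noteq> carrier G"
    then obtain g where g: "g \<in> carrier G" "g \<notin> S"
      using S subgroup.subset unfolding P_def by blast
    obtain f where f: "f \<in> characters G S" "f z \<noteq> 1" "z \<in> S" "subgroup S G"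
      using S unfolding P_def by blast
    obtain U k where U: "subgroup U G" "S \<subseteq> U" "g \<in> U" "k \<ge> 2" "g [^] (k::nat) \<in> S"
      "\<And>w. w ^ k = f (g [^] k) \<Longrightarrow> \<exists>h \<in> characters G U. h g = w \<and> (\<forall>s\<in>S. h s = f s)"
      by (rule character_extend[OF fin f(4,1) g]) (rule that)
    \<comment> \<open>A nonzero complex number has \<open>k\<close>-th roots, so an extension to
      \<open>U\<close> exists; it keeps the value at \<open>z\<close>, which lies in
      \<open>S\<close>.\<close>
    have "f (g [^] k) \<noteq> 0"
      using norm_character[OF fin f(4,1) U(5)] by auto
    then have "card {w. w ^ k = f (g [^] k)} = k"
      using \<open>k \<ge> 2\<close> by (intro card_nth_roots) auto
    then obtain w where "w ^ k = f (g [^] k)"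
      using \<open>k \<ge> 2\<close> by (cases "{w. w ^ k = f (g [^] k)} = {}") auto
    then have "P U"
      using U(1,2,6) f(2,3) unfolding P_def by (metis subsetD)
    moreover have "card S < card U"
      using U g f fin by (metis finite_subset psubset_card_mono psubsetI subgroup.subset)
    ultimately show False
      using max by fastforce
  qed
  then obtain f where "f \<in> characters G (carrier G)" "f z \<noteq> 1"
    using S unfolding P_def by blast
  then show ?thesis
    by (rule that)
qed

section \<open>Orthogonality relations\<close>

lemma (in comm_group) sum_character:
  assumes fin: "finite (carrier G)" and f: "f \<in> characters G (carrier G)"
  shows "(\<Sum>x\<in>carrier G. f x) = (if \<forall>x\<in>carrier G. f x = 1 then of_nat (order G) else 0)"
proof (cases "\<forall>x\<in>carrier G. f x = 1")
  case True
  then show ?thesis by (simp add: order_def)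
next
  case False
  then obtain y where y: "y \<in> carrier G" "f y \<noteq> 1" by blast
  \<comment> \<open>Translation by \<open>y\<close> permutes the group and multiplies the sum by
    \<open>f y\<close>, which is not 1; so the sum vanishes.\<close>
  have "(\<Sum>x\<in>carrier G. f x) = (\<Sum>x\<in>carrier G. f (y \<otimes> x))"
    using y by (intro sum.reindex_bij_witness[of _ "\<lambda>x. y \<otimes> x" "\<lambda>x. inv y \<otimes> x"])
      (auto simp: m_assoc[symmetric])
  also have "\<dots> = f y * (\<Sum>x\<in>carrier G. f x)"
    using y f by (simp add: sum_distrib_left character_mult)
  finally show ?thesis
    using y False by auto
qed

lemma character_times:
  assumes "f \<in> characters G S" "h \<in> characters G S" "\<one>\<^bsub>G\<^esub> \<in> S"
    and "\<And>x y. x \<in> S \<Longrightarrow> y \<in> S \<Longrightarrow> x \<otimes>\<^bsub>G\<^esub> y \<in> S"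
  shows "(\<lambda>x\<in>S. f x * h x) \<in> characters G S"
  using assms by (intro charactersI) (auto simp: character_one character_mult)

lemma character_inverse:
  assumes "f \<in> characters G S" "\<one>\<^bsub>G\<^esub> \<in> S"
    and "\<And>x y. x \<in> S \<Longrightarrow> y \<in> S \<Longrightarrow> x \<otimes>\<^bsub>G\<^esub> y \<in> S"
  shows "(\<lambda>x\<in>S. inverse (f x)) \<in> characters G S"
  using assms by (intro charactersI) (auto simp: character_one character_mult)

text \<open>Dual to \<open>sum_character\<close>: multiplication by a character \<open>h\<close>
  with \<open>h z \<noteq> 1\<close> permutes the characters and multiplies the sum by
  \<open>h z\<close>.\<close>

lemma (in comm_group) sum_over_characters:
  assumes fin: "finite (carrier G)" and z: "z \<in> carrier G"
  shows "(\<Sum>f\<in>characters G (carrier G). f z) =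
    (if z = \<one> then of_nat (card (characters G (carrier G))) else 0)"
proof (cases "z = \<one>")
  case True
  then show ?thesis by (simp add: character_one)
next
  case False
  let ?X = "characters G (carrier G)"
  obtain h where h: "h \<in> ?X" "h z \<noteq> 1"
    using characters_separate[OF fin z False] by blast
  have h0: "h x \<noteq> 0" if "x \<in> carrier G" for x
    using norm_character[OF fin subgroup_self h(1) that] by auto
  have "(\<Sum>f\<in>?X. f z) = (\<Sum>f\<in>?X. (\<lambda>x\<in>carrier G. h x * f x) z)"
  proof (rule sum.reindex_bij_witness[of _ "\<lambda>f. \<lambda>x\<in>carrier G. h x * f x"
        "\<lambda>f. \<lambda>x\<in>carrier G. inverse (h x) * f x"])
    fix f assume f: "f \<in> ?X"
    show "(\<lambda>x\<in>carrier G. h x * f x) \<in> ?X"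
      using h f by (intro character_times) auto
    have "(\<lambda>x\<in>carrier G. (\<lambda>x\<in>carrier G. inverse (h x)) x * f x) \<in> ?X"
      using h f by (intro character_times character_inverse) auto
    then show "(\<lambda>x\<in>carrier G. inverse (h x) * f x) \<in> ?X"
      by (simp cong: restrict_cong)
    show *: "(\<lambda>x\<in>carrier G. h x * (\<lambda>x\<in>carrier G. inverse (h x) * f x) x) = f"
      using h0 character_extensional[OF f] by (intro extensionalityI[of _ "carrier G"]) auto
    show "(\<lambda>x\<in>carrier G. inverse (h x) * (\<lambda>x\<in>carrier G. h x * f x) x) = f"
      using h0 character_extensional[OF f] by (intro extensionalityI[of _ "carrier G"]) auto
    show "(\<lambda>x\<in>carrier G. h x * (\<lambda>x\<in>carrier G. inverse (h x) * f x) x) z = f z"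
      using * by simp
  qed
  also have "\<dots> = h z * (\<Sum>f\<in>?X. f z)"
    using z by (simp add: sum_distrib_left)
  finally show ?thesis
    using h False by auto
qed

text \<open>Sum \<open>f x\<close> over all \<open>f\<close> and \<open>x\<close> in both orders:
  only the identity contributes in one, only the trivial character in the other.\<close>

lemma (in comm_group) card_characters:
  assumes fin: "finite (carrier G)"
  shows "card (characters G (carrier G)) = order G"
proof -
  let ?X = "characters G (carrier G)"
  have "finite ?X"
    using finite_characters[OF fin subgroup_self] .
  let ?t = "\<lambda>x\<in>carrier G. 1 :: complex"
  have t: "?t \<in> ?X"
    by (rule charactersI) auto
  have t_iff: "(\<forall>x\<in>carrier G. f x = 1) \<longleftrightarrow> f = ?t" if "f \<in> ?X" for f
    using character_extensional[OF that]
    by (auto intro: extensionalityI[of f "carrier G" ?t])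
  have "(of_nat (card ?X) :: complex) = (\<Sum>x\<in>carrier G. \<Sum>f\<in>?X. f x)"
    using fin by (simp add: sum_over_characters)
  also have "\<dots> = (\<Sum>f\<in>?X. \<Sum>x\<in>carrier G. f x)"
    by (rule sum.swap)
  also have "\<dots> = (\<Sum>f\<in>?X. if f = ?t then of_nat (order G) else 0)"
    using fin t_iff by (intro sum.cong) (simp_all add: sum_character)
  also have "\<dots> = of_nat (order G)"
    using t \<open>finite ?X\<close> by simp
  finally show ?thesis
    by (simp only: of_nat_eq_iff)
qed

section \<open>The action on the characters of an abelian normal subgroup\<close>

locale finite_group_abelian_normal = normal N G for N and G (structure) +
  assumes fin: "finite (carrier G)"
    and comm: "\<And>x y. x \<in> N \<Longrightarrow> y \<in> N \<Longrightarrow> x \<otimes> y = y \<otimes> x"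
begin

abbreviation Irr where "Irr \<equiv> characters G N"

text \<open>The inverse stands on the left so that \<open>twist (g \<otimes> h)\<close> is
  \<open>twist g\<close> after \<open>twist h\<close>, a left action.\<close>

definition twist :: "'a \<Rightarrow> ('a \<Rightarrow> complex) \<Rightarrow> 'a \<Rightarrow> complex" where
  "twist g f = (\<lambda>a\<in>N. f (inv g \<otimes> a \<otimes> g))"

lemma comm_group_N: "comm_group (G\<lparr>carrier := N\<rparr>)"
  using group.group_comm_groupI[OF subgroup_imp_group[OF is_subgroup]] comm by simp

lemma subgroup_N: "subgroup N G"
  by (rule is_subgroup)

lemma finite_N: "finite N"
  using fin subset finite_subset by blast

lemma card_N_pos: "card N > 0"
  using finite_N subgroup.one_closed[OF subgroup_N] by (metis card_gt_0_iff empty_iff)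

lemma cancel_inv: "x \<in> carrier G \<Longrightarrow> y \<in> carrier G \<Longrightarrow> x \<otimes> (inv x \<otimes> y) = y"
  by (simp add: m_assoc[symmetric])

lemma finite_Irr: "finite Irr"
  using finite_characters[OF fin subgroup_N] .

lemma characters_N: "characters (G\<lparr>carrier := N\<rparr>) N = Irr"
  by (simp add: characters_def)

lemma sum_character_N:
  "f \<in> Irr \<Longrightarrow> (\<Sum>x\<in>N. f x) = (if \<forall>x\<in>N. f x = 1 then of_nat (card N) else 0)"
  using comm_group.sum_character[OF comm_group_N] finite_N by (simp add: characters_N order_def)

lemma card_Irr: "card Irr = card N"
  using comm_group.card_characters[OF comm_group_N] finite_N by (simp add: characters_N order_def)

lemma sum_over_Irr:
  "z \<in> N \<Longrightarrow> (\<Sum>f\<in>Irr. f z) = (if z = \<one> then of_nat (card N) else 0)"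
  using comm_group.sum_over_characters[OF comm_group_N] finite_N
  by (simp add: characters_N order_def card_Irr)

lemma char_nonzero: "f \<in> Irr \<Longrightarrow> x \<in> N \<Longrightarrow> f x \<noteq> 0"
  using norm_character[OF fin subgroup_N] by fastforce

lemma conj_N: "g \<in> carrier G \<Longrightarrow> a \<in> N \<Longrightarrow> inv g \<otimes> a \<otimes> g \<in> N"
  by (rule inv_op_closed1)

lemma twist_Irr:
  assumes "g \<in> carrier G" "f \<in> Irr"
  shows "twist g f \<in> Irr"
proof (rule charactersI)
  show "twist g f \<in> extensional N" by (simp add: twist_def)
  show "twist g f \<one> = 1"
    using assms subgroup.one_closed[OF subgroup_N] by (simp add: twist_def character_one)
  fix x y assume xy: "x \<in> N" "y \<in> N"
  then have "inv g \<otimes> (x \<otimes> y) \<otimes> g = (inv g \<otimes> x \<otimes> g) \<otimes> (inv g \<otimes> y \<otimes> g)"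
    using assms subset by (simp add: m_assoc cancel_inv subsetD)
  then show "twist g f (x \<otimes> y) = twist g f x * twist g f y"
    using xy assms by (simp add: twist_def character_mult conj_N)
qed

lemma twist_eq_iff:
  assumes "f \<in> Irr"
  shows "twist g f = f \<longleftrightarrow> (\<forall>a\<in>N. f (inv g \<otimes> a \<otimes> g) = f a)"
proof
  assume "twist g f = f"
  then have "twist g f a = f a" for a
    by simp
  then show "\<forall>a\<in>N. f (inv g \<otimes> a \<otimes> g) = f a"
    by (metis (no_types, lifting) restrict_apply' twist_def)
next
  assume "\<forall>a\<in>N. f (inv g \<otimes> a \<otimes> g) = f a"
  then show "twist g f = f"
    using character_extensional[OF assms]
    by (intro extensionalityI[of _ N]) (auto simp: twist_def)
qed

text \<open>The summand is the value at \<open>a\<close> of the character \<open>twist g f\<close>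
  divided by \<open>f\<close>, which is trivial exactly when \<open>g\<close> fixes
  \<open>f\<close>.\<close>

lemma sum_twist:
  assumes "g \<in> carrier G" "f \<in> Irr"
  shows "(\<Sum>a\<in>N. f (inv g \<otimes> a \<otimes> g) * inverse (f a)) = of_bool (twist g f = f) * of_nat (card N)"
proof -
  have "(\<lambda>a\<in>N. twist g f a * (\<lambda>a\<in>N. inverse (f a)) a) \<in> Irr"
    using assms by (intro character_times character_inverse twist_Irr) auto
  from sum_character_N[OF this]
  have "(\<Sum>a\<in>N. f (inv g \<otimes> a \<otimes> g) * inverse (f a)) =
      (if \<forall>a\<in>N. f (inv g \<otimes> a \<otimes> g) * inverse (f a) = 1 then of_nat (card N) else 0)"
    by (simp add: twist_def)
  moreover have "(\<forall>a\<in>N. f (inv g \<otimes> a \<otimes> g) * inverse (f a) = 1) \<longleftrightarrow> twist g f = f"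
    using assms char_nonzero by (simp add: twist_eq_iff divide_inverse[symmetric])
  ultimately show ?thesis
    by simp
qed

section \<open>Commuting elements and fixed characters\<close>

lemma conj_eq_iff:
  assumes "g \<in> carrier G" "a \<in> carrier G"
  shows "inv g \<otimes> a \<otimes> g = a \<longleftrightarrow> a \<otimes> g = g \<otimes> a"
  using assms by (metis inv_closed inv_solve_left m_assoc m_closed)

text \<open>A case of Brauer's permutation lemma. In the double sum of
  \<open>f (inv g \<otimes> a \<otimes> g \<otimes> inv a)\<close>, summing over \<open>f\<close>
  first detects the \<open>a\<close> that commute with \<open>g\<close>, and summing over
  \<open>a\<close> first detects the \<open>f\<close> fixed by \<open>g\<close>, each with weight
  \<open>card N\<close>.\<close>

lemma card_fixed_eq:
  assumes g: "g \<in> carrier G"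
  shows "card {a \<in> N. a \<otimes> g = g \<otimes> a} = card {f \<in> Irr. twist g f = f}"
proof -
  have "(of_nat (card N * card {a \<in> N. a \<otimes> g = g \<otimes> a}) :: complex) =
      (\<Sum>a\<in>N. if a \<otimes> g = g \<otimes> a then of_nat (card N) else 0)"
    using finite_N by (simp add: sum.If_cases Int_def conj_commute mult.commute)
  also have "\<dots> = (\<Sum>a\<in>N. \<Sum>f\<in>Irr. f (inv g \<otimes> a \<otimes> g) * inverse (f a))"
  proof (rule sum.cong)
    fix a assume a: "a \<in> N"
    have ca: "a \<in> carrier G" using a subset by blast
    have "(\<Sum>f\<in>Irr. f (inv g \<otimes> a \<otimes> g) * inverse (f a)) = (\<Sum>f\<in>Irr. f (inv g \<otimes> a \<otimes> g \<otimes> inv a))"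
      using a g by (intro sum.cong)
        (simp_all add: character_mult conj_N character_inv[OF subgroup_N])
    also have "\<dots> = (if inv g \<otimes> a \<otimes> g \<otimes> inv a = \<one> then of_nat (card N) else 0)"
      using a g by (intro sum_over_Irr) (simp add: conj_N)
    also have "inv g \<otimes> a \<otimes> g \<otimes> inv a = \<one> \<longleftrightarrow> a \<otimes> g = g \<otimes> a"
      using g ca conj_eq_iff[OF g ca]
      by (metis inv_closed m_closed inv_equality inv_inv r_inv)
    finally show "(if a \<otimes> g = g \<otimes> a then of_nat (card N) else 0) =
        (\<Sum>f\<in>Irr. f (inv g \<otimes> a \<otimes> g) * inverse (f a))" by simp
  qed simp
  also have "\<dots> = (\<Sum>f\<in>Irr. \<Sum>a\<in>N. f (inv g \<otimes> a \<otimes> g) * inverse (f a))"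
    by (rule sum.swap)
  also have "\<dots> = (\<Sum>f\<in>Irr. of_bool (twist g f = f) * of_nat (card N))"
    using g by (simp add: sum_twist)
  also have "\<dots> = of_nat (card N * card {f \<in> Irr. twist g f = f})"
    using finite_Irr by (simp add: sum_distrib_right[symmetric] Int_def)
  finally have "card N * card {a \<in> N. a \<otimes> g = g \<otimes> a} = card N * card {f \<in> Irr. twist g f = f}"
    by (simp only: of_nat_eq_iff)
  then show ?thesis
    using card_N_pos by simp
qed

text \<open>For \<open>xa\<close> and \<open>yb\<close> to commute, an element \<open>u a b \<otimes> inv (v a b)\<close> of \<open>N\<close> must be trivial. A character
  maps it to a product of a constant \<open>f c\<close> of modulus 1, a factor in \<open>a\<close> and a factor in \<open>b\<close>, so
  the sum over \<open>a\<close> and \<open>b\<close> factorises. The constant is what reduces the equality to an inequality.\<close>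

lemma card_commuting_translates_le:
  assumes x: "x \<in> carrier G" and y: "y \<in> carrier G"
  shows "(\<Sum>a\<in>N. \<Sum>b\<in>N. of_bool ((x \<otimes> a) \<otimes> (y \<otimes> b) = (y \<otimes> b) \<otimes> (x \<otimes> a)))
    \<le> card N * card {f \<in> Irr. twist x f = f \<and> twist y f = f}" (is "?K \<le> _")
proof (cases "\<exists>a\<in>N. \<exists>b\<in>N. (x \<otimes> a) \<otimes> (y \<otimes> b) = (y \<otimes> b) \<otimes> (x \<otimes> a)")
  case False
  then have "?K = 0" by simp
  then show ?thesis by simp
next
  case True
  define c where "c = inv (y \<otimes> x) \<otimes> (x \<otimes> y)"
  define u where "u a b = c \<otimes> (inv y \<otimes> a \<otimes> y) \<otimes> b" for a b
  define v where "v a b = (inv x \<otimes> b \<otimes> x) \<otimes> a" for a b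
  have cc: "c \<in> carrier G"
    using x y by (simp add: c_def)
  have car: "a \<in> carrier G" if "a \<in> N" for a
    using that subset by blast
  have eq_iff: "(x \<otimes> a) \<otimes> (y \<otimes> b) = (y \<otimes> b) \<otimes> (x \<otimes> a) \<longleftrightarrow> u a b = v a b"
    if "a \<in> N" "b \<in> N" for a b
  proof -
    have "(x \<otimes> a) \<otimes> (y \<otimes> b) = (y \<otimes> x) \<otimes> u a b"
      unfolding u_def c_def using x y that car
      by (simp add: m_assoc[symmetric] inv_mult_group) (simp add: m_assoc)
    moreover have "(y \<otimes> b) \<otimes> (x \<otimes> a) = (y \<otimes> x) \<otimes> v a b"
      unfolding v_def using x y that car
      by (simp add: m_assoc[symmetric]) (simp add: m_assoc)
    ultimately show ?thesis
      using x y that car cc by (simp add: u_def v_def)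
  qed
  \<comment> \<open>A single commuting pair suffices to place \<open>c\<close> in \<open>N\<close>:
    solve \<open>u a0 b0 = v a0 b0\<close> for \<open>c\<close>. Only then is \<open>f c\<close> a
    character value of modulus 1.\<close>
  obtain a0 b0 where ab0: "a0 \<in> N" "b0 \<in> N" "u a0 b0 = v a0 b0"
    using True eq_iff by blast
  have vN: "v a b \<in> N" if "a \<in> N" "b \<in> N" for a b
    unfolding v_def using that x by (simp add: conj_N)
  have "c = v a0 b0 \<otimes> inv b0 \<otimes> inv (inv y \<otimes> a0 \<otimes> y)"
    using ab0 x y cc car unfolding ab0(3)[symmetric] u_def by (simp add: m_assoc)
  then have cN: "c \<in> N"
    using ab0 vN y by (simp add: conj_N)
  have uN: "u a b \<in> N" if "a \<in> N" "b \<in> N" for a b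
    unfolding u_def using that y cN by (simp add: conj_N)
  let ?T = "\<lambda>g f a. f (inv g \<otimes> a \<otimes> g) * inverse (f a)"
  have norm1: "norm (f a) = 1" if "f \<in> Irr" "a \<in> N" for f a
    using norm_character[OF fin subgroup_N that] .
  \<comment> \<open>On the unit circle inversion is conjugation, so the factor in \<open>b\<close>
    becomes the conjugate of a term that \<open>sum_twist\<close> can sum.\<close>
  have inv_cnj: "inverse z = cnj z" if "norm z = 1" for z :: complex
    using that by (metis complex_norm_square divide_self_if inverse_eq_divide inverse_unique of_real_1 one_power2)
  have fuv: "f (u a b \<otimes> inv (v a b)) = f c * ?T y f a * cnj (?T x f b)"
    if "f \<in> Irr" "a \<in> N" "b \<in> N" for f a b
  proof -
    have "f (u a b \<otimes> inv (v a b)) = f c * ?T y f a * inverse (?T x f b)"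
      using that uN vN x y cN
      by (simp add: character_mult character_inv[OF subgroup_N] u_def v_def conj_N field_simps)
    moreover have "norm (?T x f b) = 1"
      using that x by (simp add: norm_mult norm_inverse norm1 conj_N)
    ultimately show ?thesis
      by (simp only: inv_cnj)
  qed
  have "(of_nat (card N * ?K) :: complex) = (\<Sum>a\<in>N. \<Sum>b\<in>N. \<Sum>f\<in>Irr. f (u a b \<otimes> inv (v a b)))"
  proof -
    have "(\<Sum>f\<in>Irr. f (u a b \<otimes> inv (v a b))) =
        of_nat (card N) * of_bool ((x \<otimes> a) \<otimes> (y \<otimes> b) = (y \<otimes> b) \<otimes> (x \<otimes> a))"
      if ab: "a \<in> N" "b \<in> N" for a b
    proof -
      have "u a b \<otimes> inv (v a b) = \<one> \<longleftrightarrow> u a b = v a b"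
        using uN[OF ab] vN[OF ab] car by (metis inv_closed inv_equality inv_inv r_inv)
      then show ?thesis
        using sum_over_Irr[of "u a b \<otimes> inv (v a b)"] uN[OF ab] vN[OF ab] eq_iff[OF ab] by simp
    qed
    then show ?thesis
      by (simp add: sum_distrib_left)
  qed
  also have "\<dots> = (\<Sum>a\<in>N. \<Sum>b\<in>N. \<Sum>f\<in>Irr. f c * ?T y f a * cnj (?T x f b))"
    by (intro sum.cong refl fuv)
  also have "\<dots> = (\<Sum>f\<in>Irr. \<Sum>a\<in>N. \<Sum>b\<in>N. f c * ?T y f a * cnj (?T x f b))"
    by (subst (2) sum.swap, subst sum.swap) (rule refl)
  also have "\<dots> = (\<Sum>f\<in>Irr. f c * (\<Sum>a\<in>N. ?T y f a) * cnj (\<Sum>b\<in>N. ?T x f b))"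
  proof -
    have "(\<Sum>a\<in>N. \<Sum>b\<in>N. k * A a * cnj (B b)) = k * (\<Sum>a\<in>N. A a) * cnj (\<Sum>b\<in>N. B b)"
      for k :: complex and A B
      by (simp add: mult.assoc sum_distrib_left[symmetric] sum_distrib_right[symmetric])
    then show ?thesis
      by (intro sum.cong refl)
  qed
  \<comment> \<open>By \<open>sum_twist\<close> both inner sums are \<open>card N\<close> or 0, so
    only characters fixed by both \<open>x\<close> and \<open>y\<close> survive.\<close>
  also have "\<dots> = (\<Sum>f\<in>Irr. f c * (of_bool (twist y f = f) * of_nat (card N)) *
      cnj (of_bool (twist x f = f) * of_nat (card N)))"
    using x y by (intro sum.cong refl) (simp only: sum_twist)
  finally have "real (card N * ?K) = norm (\<Sum>f\<in>Irr. f c *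
      (of_bool (twist y f = f) * of_nat (card N)) * cnj (of_bool (twist x f = f) * of_nat (card N)))"
    by (simp only: norm_of_nat[symmetric, where 'a = complex])
  also have "\<dots> \<le> (\<Sum>f\<in>Irr. norm (f c *
      (of_bool (twist y f = f) * of_nat (card N)) * cnj (of_bool (twist x f = f) * of_nat (card N))))"
    by (rule norm_sum)
  also have "\<dots> = (\<Sum>f\<in>Irr. (real (card N))\<^sup>2 * of_bool (twist x f = f \<and> twist y f = f))"
    using cN by (intro sum.cong refl) (auto simp: norm_mult norm1 power2_eq_square)
  also have "\<dots> = real (card N * (card N * card {f \<in> Irr. twist x f = f \<and> twist y f = f}))"
    using finite_Irr by (simp add: sum_distrib_left[symmetric] Int_def power2_eq_square)
  finally have "card N * ?K \<le> card N * (card N * card {f \<in> Irr. twist x f = f \<and> twist y f = f})"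
    by (simp only: of_nat_le_iff)
  then show ?thesis
    using card_N_pos by simp
qed

text \<open>For fixed \<open>a\<close> and \<open>b\<close> in \<open>N\<close>, the pair
  \<open>(x, y)\<close> may be replaced by \<open>(x \<otimes> a, y \<otimes> b)\<close> in the
  count. Summing over all \<open>a\<close> and \<open>b\<close> brings in the bound for translates.
  Each \<open>f\<close> then contributes the number of pairs whose two entries both fix it, which is
  a square.\<close>

lemma card_commuting_le:
  "card N * card {(x, y) \<in> carrier G \<times> carrier G. x \<otimes> y = y \<otimes> x}
    \<le> (\<Sum>f\<in>Irr. (card {g \<in> carrier G. twist g f = f})\<^sup>2)"
proof -
  let ?C = "carrier G"
  let ?cp = "card {(x, y) \<in> ?C \<times> ?C. x \<otimes> y = y \<otimes> x}"
  have "{(x, y) \<in> ?C \<times> ?C. x \<otimes> y = y \<otimes> x} = (SIGMA x:?C. {y \<in> ?C. x \<otimes> y = y \<otimes> x})"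
    by auto
  then have cp: "?cp = (\<Sum>x\<in>?C. \<Sum>y\<in>?C. of_bool (x \<otimes> y = y \<otimes> x))"
    using fin by (simp add: Int_def)
  have shift: "(\<Sum>x\<in>?C. F x) = (\<Sum>x\<in>?C. F (x \<otimes> a))" if "a \<in> N" for F :: "'a \<Rightarrow> nat" and a
    using that subset
    by (intro sum.reindex_bij_witness[of _ "\<lambda>x. x \<otimes> a" "\<lambda>x. x \<otimes> inv a"])
      (auto simp: m_assoc subsetD)
  have swap4: "(\<Sum>a\<in>N. \<Sum>b\<in>N. \<Sum>x\<in>?C. \<Sum>y\<in>?C. F a b x y) =
      (\<Sum>x\<in>?C. \<Sum>y\<in>?C. \<Sum>a\<in>N. \<Sum>b\<in>N. F a b x y)" for F :: "'a \<Rightarrow> 'a \<Rightarrow> 'a \<Rightarrow> 'a \<Rightarrow> nat"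
  proof -
    have *: "(\<Sum>b\<in>N. \<Sum>x\<in>?C. \<Sum>y\<in>?C. H b x y) = (\<Sum>x\<in>?C. \<Sum>y\<in>?C. \<Sum>b\<in>N. H b x y)"
      for H :: "'a \<Rightarrow> 'a \<Rightarrow> 'a \<Rightarrow> nat"
      by (rule trans[OF sum.swap sum.cong[OF refl sum.swap]])
    show ?thesis
      unfolding * by (rule refl)
  qed
  \<comment> \<open>The count is repeated for each pair \<open>(a, b)\<close>; one of the two
    factors \<open>card N\<close> cancels at the end.\<close>
  have "card N * (card N * ?cp) = (\<Sum>a\<in>N. \<Sum>b\<in>N. ?cp)"
    by simp
  also have "\<dots> = (\<Sum>a\<in>N. \<Sum>b\<in>N. \<Sum>x\<in>?C. \<Sum>y\<in>?C.
      of_bool ((x \<otimes> a) \<otimes> (y \<otimes> b) = (y \<otimes> b) \<otimes> (x \<otimes> a)))"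
  proof (intro sum.cong refl)
    fix a b assume ab: "a \<in> N" "b \<in> N"
    show "?cp = (\<Sum>x\<in>?C. \<Sum>y\<in>?C. of_bool ((x \<otimes> a) \<otimes> (y \<otimes> b) = (y \<otimes> b) \<otimes> (x \<otimes> a)))"
      unfolding cp shift[OF ab(1), of "\<lambda>x. \<Sum>y\<in>?C. of_bool (x \<otimes> y = y \<otimes> x)"]
      by (intro sum.cong refl shift[OF ab(2)])
  qed
  also have "\<dots> = (\<Sum>x\<in>?C. \<Sum>y\<in>?C. \<Sum>a\<in>N. \<Sum>b\<in>N.
      of_bool ((x \<otimes> a) \<otimes> (y \<otimes> b) = (y \<otimes> b) \<otimes> (x \<otimes> a)))"
    by (rule swap4)
  also have "\<dots> \<le> (\<Sum>x\<in>?C. \<Sum>y\<in>?C. card N * card {f \<in> Irr. twist x f = f \<and> twist y f = f})"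
    by (intro sum_mono card_commuting_translates_le)
  also have "\<dots> = (\<Sum>x\<in>?C. \<Sum>y\<in>?C. card N *
      (\<Sum>f\<in>Irr. of_bool (twist x f = f) * of_bool (twist y f = f)))"
    using finite_Irr by (simp add: Int_def of_bool_conj[symmetric])
  also have "\<dots> = card N * (\<Sum>f\<in>Irr. \<Sum>x\<in>?C. \<Sum>y\<in>?C. of_bool (twist x f = f) * of_bool (twist y f = f))"
    by (simp add: sum_distrib_left sum.swap[of _ Irr])
  also have "\<dots> = card N * (\<Sum>f\<in>Irr. (card {g \<in> ?C. twist g f = f})\<^sup>2)"
  proof -
    have "(\<Sum>x\<in>?C. of_bool (twist x f = f)) = card {g \<in> ?C. twist g f = f}" for f
      using fin by (simp add: Int_def)
    then show ?thesis
      by (simp only: power2_eq_square sum_product[symmetric])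
  qed
  finally have "card N * (card N * ?cp) \<le> card N * (\<Sum>f\<in>Irr. (card {g \<in> ?C. twist g f = f})\<^sup>2)" .
  then show ?thesis
    using card_N_pos by simp
qed

text \<open>Makes the orbit-stabilizer theorem available for characters. Restriction to
  \<open>Irr\<close> gives the extensional maps that \<open>BijGroup Irr\<close> consists
  of.\<close>

lemma twist_action: "group_action G Irr (\<lambda>g. \<lambda>f\<in>Irr. twist g f)"
proof -
  have one: "twist \<one> f = f" if "f \<in> Irr" for f
    using that subset by (subst twist_eq_iff) (auto simp: subsetD)
  have comp: "twist (g \<otimes> h) f = twist g (twist h f)"
    if "g \<in> carrier G" "h \<in> carrier G" for g h f
  proof -
    have "inv (g \<otimes> h) \<otimes> a \<otimes> (g \<otimes> h) = inv h \<otimes> (inv g \<otimes> a \<otimes> g) \<otimes> h" if "a \<in> N" for a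
      using that \<open>g \<in> carrier G\<close> \<open>h \<in> carrier G\<close> subset by (simp add: inv_mult_group m_assoc subsetD)
    then show ?thesis
      unfolding twist_def using that by (intro restrict_ext) (simp add: conj_N)
  qed
  have bij: "(\<lambda>f\<in>Irr. twist g f) \<in> Bij Irr" if g: "g \<in> carrier G" for g
  proof -
    have "bij_betw (\<lambda>f\<in>Irr. twist g f) Irr Irr"
      using g by (intro bij_betw_byWitness[of _ "twist (inv g)"])
        (auto simp: twist_Irr comp[symmetric] one)
    then show ?thesis by (simp add: Bij_def)
  qed
  have "(\<lambda>g. \<lambda>f\<in>Irr. twist g f) \<in> hom G (BijGroup Irr)"
  proof (rule homI)
    show "(\<lambda>f\<in>Irr. twist g f) \<in> carrier (BijGroup Irr)" if "g \<in> carrier G" for g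
      using bij[OF that] by (simp add: BijGroup_def)
    show "(\<lambda>f\<in>Irr. twist (g \<otimes> h) f) = (\<lambda>f\<in>Irr. twist g f) \<otimes>\<^bsub>BijGroup Irr\<^esub> (\<lambda>f\<in>Irr. twist h f)"
      if "g \<in> carrier G" "h \<in> carrier G" for g h
      using that bij by (auto simp: BijGroup_def compose_def comp twist_Irr intro!: restrict_ext)
  qed
  then show ?thesis
    unfolding group_action_def group_hom_def group_hom_axioms_def
    by (simp add: group_BijGroup is_group)
qed

text \<open>Count the pairs of a group element and a character fixed by it. For each
  \<open>g\<close>, \<open>card_fixed_eq\<close> exchanges fixed characters for elements of
  \<open>N\<close> commuting with \<open>g\<close>. Thus the class sizes in \<open>N\<close> control
  the average stabilizer of a character.\<close>

lemma sum_stabilizers_eq: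
  "(\<Sum>f\<in>Irr. card {g \<in> carrier G. twist g f = f}) = (\<Sum>a\<in>N. card {g \<in> carrier G. a \<otimes> g = g \<otimes> a})"
proof -
  have "(\<Sum>f\<in>Irr. card {g \<in> carrier G. twist g f = f}) = (\<Sum>g\<in>carrier G. card {f \<in> Irr. twist g f = f})"
    by (rule sum_multicount_gen) (use finite_Irr fin in auto)
  also have "\<dots> = (\<Sum>g\<in>carrier G. card {a \<in> N. a \<otimes> g = g \<otimes> a})"
    by (simp add: card_fixed_eq)
  also have "\<dots> = (\<Sum>a\<in>N. card {g \<in> carrier G. a \<otimes> g = g \<otimes> a})"
    by (rule sum_multicount_gen[symmetric]) (use finite_N fin in auto)
  finally show ?thesis .
qed

end

section \<open>Class sizes and the commuting probability\<close>

lemma (in group) stabilizer_conjugation: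
  assumes "x \<in> carrier G"
  shows "stabilizer G (\<lambda>g. \<lambda>h\<in>carrier G. g \<otimes> h \<otimes> inv g) x = {g \<in> carrier G. x \<otimes> g = g \<otimes> x}"
proof -
  have "g \<otimes> x \<otimes> inv g = x \<longleftrightarrow> x \<otimes> g = g \<otimes> x" if "g \<in> carrier G" for g
    using inv_solve_right'[of x "g \<otimes> x" g] that assms by auto
  then show ?thesis
    using assms by (auto simp: stabilizer_def)
qed

lemma (in group) card_conjugacy_class_mult:
  assumes "x \<in> carrier G"
  shows "card (orbit G (\<lambda>g. \<lambda>h\<in>carrier G. g \<otimes> h \<otimes> inv g) x) * card {g \<in> carrier G. x \<otimes> g = g \<otimes> x} = order G"
  using group_action.orbit_stabilizer_theorem[OF action_by_conjugation assms]
  by (simp add: stabilizer_conjugation[OF assms])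

text \<open>If some \<open>\<beta> f\<close> is below \<open>1 / s\<close>, its orbit alone makes the sum of \<open>\<beta> - \<beta>\<^sup>2\<close> large enough. Otherwise
  \<open>(\<beta> f - 1 / s) * (1 - \<beta> f) \<ge> 0\<close> bounds the squares linearly.\<close>

lemma sum_squares_le:
  fixes \<beta> :: "'f \<Rightarrow> real" and s n :: real
  assumes "finite A" "card A = n" "s > 1" "n \<ge> s + 1"
    and \<beta>: "\<And>f. f \<in> A \<Longrightarrow> 0 < \<beta> f" "\<And>f. f \<in> A \<Longrightarrow> \<beta> f \<le> 1"
    and sum: "(\<Sum>f\<in>A. \<beta> f) \<le> 1 + (n - 1) / s"
    and orbit: "\<And>f. f \<in> A \<Longrightarrow> \<exists>B\<subseteq>A. card B * \<beta> f = 1 \<and> (\<forall>h\<in>B. \<beta> h = \<beta> f)"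
  shows "(\<Sum>f\<in>A. (\<beta> f)\<^sup>2) \<le> n / s"
proof (cases "\<exists>f\<in>A. \<beta> f < 1 / s")
  case True
  then obtain f B where f: "f \<in> A" "\<beta> f < 1 / s" and B: "B \<subseteq> A" "card B * \<beta> f = 1"
    "\<forall>h\<in>B. \<beta> h = \<beta> f"
    using orbit by meson
  \<comment> \<open>An orbit has total weight 1, so its share of the sum is
    \<open>1 - \<beta> f\<close>.\<close>
  have "1 - 1 / s \<le> card B * \<beta> f * (1 - \<beta> f)"
    using B f by simp
  also have "\<dots> = (\<Sum>h\<in>B. \<beta> h - (\<beta> h)\<^sup>2)"
    using B(3) by (simp add: power2_eq_square algebra_simps)
  also have "\<dots> \<le> (\<Sum>h\<in>A. \<beta> h - (\<beta> h)\<^sup>2)"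
  proof (rule sum_mono2)
    fix h assume "h \<in> A - B"
    then show "0 \<le> \<beta> h - (\<beta> h)\<^sup>2"
      using \<beta>[of h] by (simp add: power2_eq_square mult_left_le)
  qed (use assms B in auto)
  also have "\<dots> \<le> 1 + (n - 1) / s - (\<Sum>h\<in>A. (\<beta> h)\<^sup>2)"
    using sum by (simp add: sum_subtractf)
  \<comment> \<open>The upper bound \<open>1 + (n - 1) / s\<close> less the lower bound
    \<open>1 - 1 / s\<close> is exactly \<open>n / s\<close>.\<close>
  finally show ?thesis
    by (simp add: diff_divide_distrib)
next
  case False
  have "(\<Sum>f\<in>A. (\<beta> f)\<^sup>2) \<le> (\<Sum>f\<in>A. \<beta> f * (1 + 1 / s) - 1 / s)"
  proof (rule sum_mono)
    fix f assume "f \<in> A"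
    then have "(\<beta> f - 1 / s) * (1 - \<beta> f) \<ge> 0"
      using False \<beta> by (intro mult_nonneg_nonneg) (auto simp: not_less)
    then show "(\<beta> f)\<^sup>2 \<le> \<beta> f * (1 + 1 / s) - 1 / s"
      by (simp add: power2_eq_square algebra_simps)
  qed
  also have "\<dots> = (\<Sum>f\<in>A. \<beta> f) * (1 + 1 / s) - n / s"
    using assms(2) by (simp add: sum_subtractf sum_distrib_right)
  also have "\<dots> \<le> (1 + (n - 1) / s) * (1 + 1 / s) - n / s"
    using sum \<open>s > 1\<close> by (intro diff_right_mono mult_right_mono) auto
  also have "\<dots> \<le> n / s"
  proof -
    \<comment> \<open>The slack in the claim is \<open>(s - 1) * (n - (s + 1)) / s\<^sup>2\<close>,
      nonnegative because \<open>n \<ge> s + 1\<close>.\<close>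
    have "(s - 1) * (n - (s + 1)) \<ge> 0"
      using assms by simp
    then have "(s - 1) * (n - (s + 1)) / s\<^sup>2 \<ge> 0"
      by simp
    moreover have "n / s - ((1 + (n - 1) / s) * (1 + 1 / s) - n / s) = (s - 1) * (n - (s + 1)) / s\<^sup>2"
      using \<open>s > 1\<close> by (simp add: field_simps power2_eq_square)
    ultimately show ?thesis
      by linarith
  qed
  finally show ?thesis .
qed

context finite_group_abelian_normal
begin

lemma conjugacy_class_subset:
  assumes "x \<in> N" "x \<noteq> \<one>"
  shows "orbit G (\<lambda>g. \<lambda>h\<in>carrier G. g \<otimes> h \<otimes> inv g) x \<subseteq> N - {\<one>}"
proof
  fix z assume "z \<in> orbit G (\<lambda>g. \<lambda>h\<in>carrier G. g \<otimes> h \<otimes> inv g) x"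
  then obtain g where g: "g \<in> carrier G" "z = g \<otimes> x \<otimes> inv g"
    using assms subset by (auto simp: orbit_def)
  have "z \<in> N"
    using g assms inv_op_closed2 by simp
  moreover have "z \<noteq> \<one>"
  proof
    assume "z = \<one>"
    then have "g \<otimes> x = g \<otimes> \<one>"
      using g assms subset by (simp add: inv_solve_right' subsetD)
    then show False
      using g assms subset by (auto simp: subsetD)
  qed
  ultimately show "z \<in> N - {\<one>}" by simp
qed

text \<open>Provides the sets \<open>B\<close> required by \<open>sum_squares_le\<close>. Members of
  one orbit have the same orbit, hence by orbit-stabilizer equally large stabilizers.\<close>

lemma twist_orbit:
  assumes f: "f \<in> Irr"
  obtains B where "B \<subseteq> Irr" "card B * card {g \<in> carrier G. twist g f = f} = order G"
    "\<And>h. h \<in> B \<Longrightarrow> card {g \<in> carrier G. twist g h = h} = card {g \<in> carrier G. twist g f = f}"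
proof -
  let ?\<phi> = "\<lambda>g. \<lambda>f\<in>Irr. twist g f"
  interpret A: group_action G Irr ?\<phi>
    by (rule twist_action)
  have st: "stabilizer G ?\<phi> h = {g \<in> carrier G. twist g h = h}" if "h \<in> Irr" for h
    using that by (auto simp: stabilizer_def)
  have O: "orbit G ?\<phi> f \<subseteq> Irr"
    using f by (auto simp: orbit_def twist_Irr)
  have "card (orbit G ?\<phi> f) \<noteq> 0"
    using A.orbit_stabilizer_theorem[OF f] order_gt_0_iff_finite fin by (intro notI) simp
  have eq: "card (stabilizer G ?\<phi> h) = card (stabilizer G ?\<phi> f)" if "h \<in> orbit G ?\<phi> f" for h
  proof -
    have h: "h \<in> Irr" using O that by blast
    have "h \<in> orbit G ?\<phi> h"
      by (rule A.orbit_refl[OF h])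
    \<comment> \<open>Both orbits contain \<open>h\<close>, and orbits that meet coincide.\<close>
    then have "orbit G ?\<phi> h = orbit G ?\<phi> f"
      using A.disjoint_union[of "orbit G ?\<phi> h" "orbit G ?\<phi> f"] that f h
      unfolding orbits_def by blast
    then show ?thesis
      using A.orbit_stabilizer_theorem[OF f] A.orbit_stabilizer_theorem[OF h]
        \<open>card (orbit G ?\<phi> f) \<noteq> 0\<close> by (metis mult_cancel1)
  qed
  show ?thesis
  proof (rule that[OF O])
    show "card (orbit G ?\<phi> f) * card {g \<in> carrier G. twist g f = f} = order G"
      using A.orbit_stabilizer_theorem[OF f] by (simp only: st[OF f])
    show "card {g \<in> carrier G. twist g h = h} = card {g \<in> carrier G. twist g f = f}"
      if "h \<in> orbit G ?\<phi> f" for h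
      using eq[OF that] by (simp only: st[OF f] st[OF subsetD[OF O that]])
  qed
qed

text \<open>Contrapositive form of the bound on classes. Large classes in \<open>N\<close> mean
  small centralizers, hence a small sum of stabilizer sizes over the characters. Then
  \<open>sum_squares_le\<close> bounds the sum of their squares, and
  \<open>card_commuting_le\<close> the number of commuting pairs.\<close>

lemma commuting_probability_le:
  assumes "s \<ge> 2" "N \<noteq> {\<one>}"
    and large: "\<And>x. x \<in> N \<Longrightarrow> x \<noteq> \<one> \<Longrightarrow>
      card (orbit G (\<lambda>g. \<lambda>h\<in>carrier G. g \<otimes> h \<otimes> inv g) x) \<ge> s"
  shows "commuting_probability G \<le> 1 / real s"
proof -
  define n where "n = card N"
  let ?O = "real (order G)"
  \<comment> \<open>By orbit-stabilizer this is the reciprocal of the orbit size of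
    \<open>f\<close>.\<close>
  define \<beta> where "\<beta> f = card {g \<in> carrier G. twist g f = f} / ?O" for f
  have O: "?O > 0"
    using fin order_gt_0_iff_finite by simp
  \<comment> \<open>A nontrivial class in \<open>N\<close> has at least \<open>s\<close> elements
    and avoids the identity, which accounts for the extra 1.\<close>
  have "n \<ge> s + 1"
  proof -
    obtain x where x: "x \<in> N" "x \<noteq> \<one>"
      using assms(2) subgroup.one_closed[OF subgroup_N] by blast
    have "s \<le> card (N - {\<one>})"
      using large[OF x] card_mono[OF _ conjugacy_class_subset[OF x]] finite_N by simp
    then show ?thesis
      using subgroup.one_closed[OF subgroup_N] finite_N card_N_pos by (simp add: n_def)
  qed
  have centralizer: "card {g \<in> carrier G. x \<otimes> g = g \<otimes> x} \<le> ?O / s" if x: "x \<in> N" "x \<noteq> \<one>" for x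
  proof -
    have "s * card {g \<in> carrier G. x \<otimes> g = g \<otimes> x} \<le> order G"
      unfolding card_conjugacy_class_mult[OF subsetD[OF subset x(1)], symmetric]
      by (rule mult_le_mono1[OF large[OF x]])
    then have "real s * card {g \<in> carrier G. x \<otimes> g = g \<otimes> x} \<le> ?O"
      by (metis of_nat_le_iff of_nat_mult)
    then show ?thesis
      using assms(1) by (simp add: field_simps)
  qed
  have "(\<Sum>f\<in>Irr. (\<beta> f)\<^sup>2) \<le> real n / real s"
  proof (rule sum_squares_le)
    show "finite Irr" "real (card Irr) = real n" "real s > 1" "real n \<ge> real s + 1"
      using finite_Irr card_Irr assms(1) \<open>n \<ge> s + 1\<close> by (auto simp: n_def)
    show "\<exists>B\<subseteq>Irr. real (card B) * \<beta> f = 1 \<and> (\<forall>h\<in>B. \<beta> h = \<beta> f)" if f: "f \<in> Irr" for f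
    proof -
      obtain B where B: "B \<subseteq> Irr" "card B * card {g \<in> carrier G. twist g f = f} = order G"
        "\<And>h. h \<in> B \<Longrightarrow> card {g \<in> carrier G. twist g h = h} = card {g \<in> carrier G. twist g f = f}"
        using twist_orbit[OF f] by blast
      have "real (card B) * card {g \<in> carrier G. twist g f = f} = ?O"
        by (metis B(2) of_nat_mult)
      then show ?thesis
        using B(1,3) O unfolding \<beta>_def by (intro exI[of _ B]) simp
    qed
    show "0 < \<beta> f" if "f \<in> Irr" for f
      using twist_orbit[OF that] O unfolding \<beta>_def
      by (metis divide_pos_pos gr0I mult_0_right of_nat_0_less_iff)
    show "\<beta> f \<le> 1" for f
      using O fin card_mono[of "carrier G" "{g \<in> carrier G. twist g f = f}"]
      by (simp add: \<beta>_def order_def)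
    have "(\<Sum>f\<in>Irr. \<beta> f) * ?O = (\<Sum>f\<in>Irr. card {g \<in> carrier G. twist g f = f})"
      using O by (simp add: \<beta>_def sum_divide_distrib[symmetric])
    also have "\<dots> = (\<Sum>a\<in>N. real (card {g \<in> carrier G. a \<otimes> g = g \<otimes> a}))"
      by (simp add: sum_stabilizers_eq)
    \<comment> \<open>Everything centralizes the identity; by \<open>centralizer\<close>, any other
      \<open>a\<close> commutes with at most a fraction \<open>1 / s\<close> of the group.\<close>
    also have "\<dots> \<le> (\<Sum>a\<in>N. if a = \<one> then ?O else ?O / s)"
    proof (rule sum_mono)
      fix a assume "a \<in> N"
      then show "real (card {g \<in> carrier G. a \<otimes> g = g \<otimes> a}) \<le> (if a = \<one> then ?O else ?O / s)"
        using centralizer[of a] by (auto simp: order_def fin intro!: card_mono)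
    qed
    also have "\<dots> = ?O + (real n - 1) * (?O / s)"
    proof -
      have "N = insert \<one> (N - {\<one>})"
        using subgroup.one_closed[OF subgroup_N] by blast
      then have "(\<Sum>a\<in>N. if a = \<one> then ?O else ?O / s) = ?O + (\<Sum>a\<in>N - {\<one>}. ?O / s)"
        using sum.remove[OF finite_N subgroup.one_closed[OF subgroup_N], of "\<lambda>a. if a = \<one> then ?O else ?O / s"]
        by simp
      then show ?thesis
        using card_N_pos subgroup.one_closed[OF subgroup_N] finite_N by (simp add: n_def of_nat_diff)
    qed
    also have "\<dots> = (1 + (real n - 1) / s) * ?O"
      by (simp add: algebra_simps)
    finally show "(\<Sum>f\<in>Irr. \<beta> f) \<le> 1 + (real n - 1) / real s"
      using O by simp
  qed
  then have "(\<Sum>f\<in>Irr. (\<beta> f)\<^sup>2) * ?O\<^sup>2 \<le> real n / real s * ?O\<^sup>2"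
    by (rule mult_right_mono) simp
  moreover have "(\<Sum>f\<in>Irr. (\<beta> f)\<^sup>2) * ?O\<^sup>2 = real (\<Sum>f\<in>Irr. (card {g \<in> carrier G. twist g f = f})\<^sup>2)"
    using O by (simp add: \<beta>_def power_divide sum_divide_distrib[symmetric])
  moreover have "real n * commuting_probability G * ?O\<^sup>2
      = real (card N * card {(x, y) \<in> carrier G \<times> carrier G. x \<otimes> y = y \<otimes> x})"
    using O by (simp add: commuting_probability_def n_def)
  ultimately have "real n * commuting_probability G * ?O\<^sup>2 \<le> real n / real s * ?O\<^sup>2"
    using of_nat_mono[OF card_commuting_le, where 'a = real] by linarith
  then have "real n * commuting_probability G \<le> real n / real s"
    by (rule mult_right_le_imp_le) (use O in simp)
  then have "real n * commuting_probability G \<le> real n * (1 / real s)"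
    by simp
  then show ?thesis
    using card_N_pos unfolding n_def by (simp only: mult_le_cancel_left_pos of_nat_0_less_iff)
qed

end

theorem theorem4:
  fixes G :: "('a, 'b) monoid_scheme" (structure) and N :: "'a set" and s :: nat
  assumes "s \<ge> 2"
    and "group G" and "finite (carrier G)"
    and "commuting_probability G > 1 / real s"
    and "N \<lhd> G" and "comm_group (G\<lparr>carrier := N\<rparr>)" and "N \<noteq> {\<one>}"
    and "splits_over G N"
  shows "(\<exists>C \<in> conjugacy_classes G. C \<noteq> {\<one>} \<and> C \<subseteq> N \<and> card C \<le> s - 1) \<and>
         (group_center G \<noteq> {\<one>} \<or>
          (\<exists>K. subgroup K G \<and> K \<noteq> carrier G \<and> card (rcosets K) \<le> s - 1))"
proof -
  interpret normal N G by fact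
  interpret finite_group_abelian_normal N G
  proof
    show "x \<otimes> y = y \<otimes> x" if "x \<in> N" "y \<in> N" for x y
      using comm_monoid.m_comm[OF comm_group.axioms(1)[OF assms(6)]] that by simp
  qed fact
  let ?cl = "orbit G (\<lambda>g. \<lambda>h\<in>carrier G. g \<otimes> h \<otimes> inv g)"
  obtain x where x: "x \<in> N" "x \<noteq> \<one>" and small: "card (?cl x) < s"
    using commuting_probability_le[OF assms(1,7)] assms(4) by (meson linorder_not_less)
  have xG: "x \<in> carrier G"
    using x subset by blast
  interpret A: group_action G "carrier G" "\<lambda>g. \<lambda>h\<in>carrier G. g \<otimes> h \<otimes> inv g"
    by (rule action_by_conjugation)
  have "?cl x \<in> conjugacy_classes G"
    using xG by (auto simp: conjugacy_classes_def orbits_def)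
  moreover have "?cl x \<noteq> {\<one>}" "?cl x \<subseteq> N"
    using conjugacy_class_subset[OF x] by auto
  moreover have "card (?cl x) \<le> s - 1"
    using small by simp
  ultimately have 1: "\<exists>C \<in> conjugacy_classes G. C \<noteq> {\<one>} \<and> C \<subseteq> N \<and> card C \<le> s - 1"
    by blast
  \<comment> \<open>The centralizer of \<open>x\<close> has the size of the class of
    \<open>x\<close> as its index. Either it is all of \<open>G\<close> and \<open>x\<close> is a
    nontrivial central element, or it is the proper subgroup sought.\<close>
  define K where "K = {g \<in> carrier G. x \<otimes> g = g \<otimes> x}"
  have K: "subgroup K G"
    using A.stabilizer_subgroup[OF xG] by (simp add: K_def stabilizer_conjugation[OF xG])
  have 2: "group_center G \<noteq> {\<one>} \<or>
      (\<exists>K. subgroup K G \<and> K \<noteq> carrier G \<and> card (rcosets K) \<le> s - 1)"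
  proof (cases "K = carrier G")
    case True
    then have "x \<in> group_center G"
      using xG unfolding K_def group_center_def by blast
    then show ?thesis using x by blast
  next
    case False
    have "card K > 0"
      using K fin subgroup.finite_imp_card_positive by blast
    \<comment> \<open>Both products equal \<open>order G\<close>, by Lagrange and by
      orbit-stabilizer.\<close>
    moreover have "card (rcosets K) * card K = card (?cl x) * card K"
      using lagrange[OF K] card_conjugacy_class_mult[OF xG] by (simp add: K_def)
    ultimately have "card (rcosets K) \<le> s - 1"
      using small by simp
    then show ?thesis using K False by blast
  qed
  from 1 2 show ?thesis ..
qed

end
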